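(* Let the data and notation be as in the context. Suppose that $\max I^+=\theta$ and that $\psi=0$ (no correction for high induction factors, so that $\mu_G^c=\mu_G$). Assume that $\mu_L^c$ and $\mu_D^c$ are continuously differentiable and non-decreasing on $I^+$, and that the equation $$\mu_L^c(\varphi)-\tan(\theta-\varphi)\,\mu_D^c(\varphi)=\mu_G(\varphi)\qquad(\mathrm{E})$$ admits a solution in $I^+$. Let $\varepsilon\in(0,1)$, and define $$\rho_\varepsilon(\varphi):=\frac{\varepsilon}{\max\{0,-\mu_G'(\varphi)\}+\max_{I^+}(\mu_L^c)'+(1+\tan^2\theta)\,\mu_D^c(\varphi)},$$ $$f(\varphi):=\varphi+\rho_\varepsilon(\varphi)\bigl(\mu_G(\varphi)-\mu_L^c(\varphi)+\tan(\theta-\varphi)\,\mu_D^c(\varphi)\bigr).$$ Then the sequence $(\varphi^k)_{k\in\mathbb{N}}$ defined by $\varphi^0=\theta$ and $\varphi^{k+1}=f(\varphi^k)$ converges to $\varphi^\star$, the largest solution of (E) in $I^+$.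
   Context: Fixed data: real numbers $\lambda>0$ (local speed ratio), $\sigma>0$ (solidity), $\gamma\in(-\frac\pi2,\frac\pi2)$ (twist), $\beta>0$; an integer $B\ge1$ (number of blades) and $s\in(0,1)$ (relative radial position $r/R$); a function $C_L:[-\beta,\beta]\to\mathbb{R}$ continuous on $[-\beta,\beta]$ and positive on $(0,\beta]$; a function $C_D:\mathbb{R}\to\mathbb{R}$ continuous and non-negative. Notation: $\theta\in(0,\frac\pi2)$ is defined by $\tan\theta=1/\lambda$; $I:=[-\beta+\gamma,\beta+\gamma]\cap(-\frac\pi2+\theta,\frac\pi2+\theta)$ and $I^+:=I\cap(0,\theta]$. The tip loss factor is $F(\varphi):=\frac2\pi\arccos\Bigl(\exp\bigl(-\frac{(B/2)(1-s)}{s\,\sin\varphi}\bigr)\Bigr)$ for $\varphi\in(0,\frac\pi2)$. For $\varphi\in I^+$: $\mu_L^c(\varphi):=\frac{\sigma}{4F(\varphi)}C_L(\varphi-\gamma)$, $\mu_D^c(\varphi):=\frac{\sigma}{4F(\varphi)}C_D(\varphi-\gamma)$, $\mu_G(\varphi):=\sin\varphi\,\tan(\theta-\varphi)$. Primes denote derivatives in $\varphi$ (one-sided at endpoints). The maximum $\max_{I^+}(\mu_L^c)'$ is assumed to exist. *)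

theory Defs
  imports "HOL-Analysis.Analysis"
begin

definition is_greatest :: "real set \<Rightarrow> real \<Rightarrow> bool" where
  "is_greatest S m \<longleftrightarrow> m \<in> S \<and> (\<forall>x\<in>S. x \<le> m)"

definition I_set :: "real \<Rightarrow> real \<Rightarrow> real \<Rightarrow> real set" where
  "I_set \<theta> \<gamma> \<beta> = {- \<beta> + \<gamma>..\<beta> + \<gamma>} \<inter> {- (pi / 2) + \<theta><..<pi / 2 + \<theta>}"

definition I_plus :: "real \<Rightarrow> real \<Rightarrow> real \<Rightarrow> real set" where
  "I_plus \<theta> \<gamma> \<beta> = I_set \<theta> \<gamma> \<beta> \<inter> {0<..\<theta>}"

definition tip_loss :: "nat \<Rightarrow> real \<Rightarrow> real \<Rightarrow> real" where
  "tip_loss B s \<phi> = 2 / pi * arccos (exp (- ((real B / 2) * (1 - s) / (s * sin \<phi>))))"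

text \<open>The lift coefficient \<open>C = C_L\<close> gives \<open>\<mu>_L^c\<close>, the drag coefficient \<open>C = C_D\<close>
  gives \<open>\<mu>_D^c\<close>. Only the values of \<open>C\<close> at \<open>\<phi> - \<gamma>\<close> for \<open>\<phi>\<close> in \<open>I_plus \<theta> \<gamma> \<beta>\<close> are meaningful;
  for these \<open>\<phi> - \<gamma>\<close> lies in \<open>[-\<beta>, \<beta>]\<close>.\<close>

definition mu_c :: "real \<Rightarrow> nat \<Rightarrow> real \<Rightarrow> real \<Rightarrow> (real \<Rightarrow> real) \<Rightarrow> real \<Rightarrow> real" where
  "mu_c \<sigma> B s \<gamma> C \<phi> = \<sigma> / (4 * tip_loss B s \<phi>) * C (\<phi> - \<gamma>)"

definition mu_G :: "real \<Rightarrow> real \<Rightarrow> real" where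
  "mu_G \<theta> \<phi> = sin \<phi> * tan (\<theta> - \<phi>)"

end

theory Submission
  imports Defs
begin

text \<open>
  With \<open>g = \<mu>_G - \<mu>_L + tan (\<theta> - \<cdot>) \<mu>_D\<close> and \<open>D\<close> the denominator of \<open>\<rho>\<close>, the iteration is
  \<open>x \<mapsto> x + \<epsilon> g x / D x\<close>. At a solution \<open>\<mu>_L \<ge> 0\<close>, so \<open>g \<theta> = - \<mu>_L \<theta> \<le> 0\<close> and hence \<open>g < 0\<close> to the
  right of the largest solution \<open>a\<close>. The three summands of \<open>D\<close> bound the corresponding parts of \<open>- g'\<close>, and
  \<open>D\<close> is non-decreasing because \<open>\<mu>_G\<close> is concave; so the mean value theorem gives
  \<open>0 < - g x \<le> D x (x - a)\<close> for \<open>x > a\<close>. Thus \<open>D x > 0\<close>, the iterates decrease without passing \<open>a\<close>, and, \<open>D\<close>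
  being bounded, their limit is a zero of \<open>g\<close>.
\<close>

section \<open>Zeros and damped iterations on a real interval\<close>

lemma greatest_zero_exists:
  fixes g :: "real \<Rightarrow> real"
  assumes cont: "continuous_on {c..b} g" and "c \<le> b" and "g c = 0" and gb: "g b \<le> 0"
  obtains a where "a \<in> {c..b}" "g a = 0" "\<And>x. x \<in> {a<..b} \<Longrightarrow> g x < 0"
proof -
  define Z where "Z = {x \<in> {c..b}. g x = 0}"
  have "compact Z"
    unfolding Z_def compact_eq_bounded_closed
    using continuous_closed_preimage_constant[OF cont, of 0]
    by (auto intro: bounded_subset[OF bounded_closed_interval[of c b]])
  moreover have "Z \<noteq> {}"
    using assms by (auto simp: Z_def)
  ultimately obtain a where a: "a \<in> Z" and max: "\<forall>x\<in>Z. x \<le> a"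
    using compact_attains_sup[of Z] by auto
  have "g x < 0" if x: "x \<in> {a<..b}" for x
  \<comment> \<open>A non-negative value at \<open>x\<close> and \<open>g b \<le> 0\<close> would
    give, by the intermediate value theorem, a zero in \<open>{x..b}\<close>, beyond the maximal
    zero \<open>a\<close>.\<close>
  proof (rule ccontr)
    assume "\<not> g x < 0"
    moreover have "continuous_on {x..b} g"
      using cont by (rule continuous_on_subset) (use a x in \<open>auto simp: Z_def\<close>)
    ultimately obtain y where "x \<le> y" "y \<le> b" "g y = 0"
      using IVT2'[of g b 0 x] gb x by auto
    with a x bspec[OF max, of y] show False
      by (auto simp: Z_def)
  qed
  with a show ?thesis
    by (intro that[of a]) (auto simp: Z_def)
qed

text \<open>By \<open>slope\<close>, the undamped step \<open>- g x / D x\<close> is at most the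
  distance to \<open>a\<close>, so a step damped by \<open>\<epsilon> \<le> 1\<close> cannot pass
  \<open>a\<close>. The upper bound \<open>K\<close> keeps the steps from shrinking unless
  \<open>g\<close> itself tends to zero.\<close>

lemma damped_iteration_tendsto_zero:
  fixes g D :: "real \<Rightarrow> real" and u :: "nat \<Rightarrow> real"
  assumes cont: "continuous_on {a..b} g" and "a \<le> b"
    and ga: "g a = 0" and neg: "\<And>x. x \<in> {a<..b} \<Longrightarrow> g x < 0"
    and slope: "\<And>x. x \<in> {a<..b} \<Longrightarrow> - g x \<le> D x * (x - a)"
    and bound: "\<And>x. x \<in> {a<..b} \<Longrightarrow> D x \<le> K"
    and eps: "0 < \<epsilon>" "\<epsilon> \<le> 1"
    and u0: "u 0 = b" and uS: "\<And>k. u (Suc k) = u k + \<epsilon> / D (u k) * g (u k)"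
  shows "u k \<in> {a..b}" and "u \<longlonglongrightarrow> a"
proof -
  have D_pos: "D x > 0" if "x \<in> {a<..b}" for x
  proof -
    have "0 < D x * (x - a)"
      using neg[OF that] slope[OF that] by linarith
    then show ?thesis
      using that by (simp add: zero_less_mult_iff)
  qed
  \<comment> \<open>The second conjunct is \<open>D \<le> K\<close> solved for \<open>g\<close>: it
    controls \<open>- g\<close> by the step length without division by \<open>D\<close>, so it
    survives the limit.\<close>
  have step: "u (Suc k) \<in> {a..u k} \<and> - g (u k) \<le> K / \<epsilon> * (u k - u (Suc k))"
    if "u k \<in> {a..b}" for k
  proof (cases "u k = a")
    \<comment> \<open>Nothing is assumed about \<open>D a\<close>; since \<open>g a = 0\<close>, the
      increment vanishes whatever \<open>\<epsilon> / D a\<close> is.\<close>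
    case True
    then show ?thesis
      using ga uS[of k] by simp
  next
    case False
    define x where "x = u k"
    have x: "x \<in> {a<..b}"
      using that False by (auto simp: x_def)
    have d: "u k - u (Suc k) = \<epsilon> * (- g x / D x)"
      by (simp add: uS x_def)
    have q: "0 \<le> - g x / D x" "- g x / D x \<le> x - a"
      using neg[OF x] slope[OF x] D_pos[OF x]
      by (simp_all add: pos_divide_le_eq mult.commute del: divide_minus_left)
    have "\<epsilon> * (- g x / D x) \<le> - g x / D x"
      using mult_right_mono[OF eps(2) q(1)] by simp
    moreover have "0 \<le> \<epsilon> * (- g x / D x)"
      using eps q by (intro mult_nonneg_nonneg) auto
    moreover have "- g x \<le> K * (- g x / D x)"
      using mult_right_mono[OF bound[OF x] q(1)] D_pos[OF x] by simp
    moreover have "K / \<epsilon> * (\<epsilon> * (- g x / D x)) = K * (- g x / D x)"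
      using eps by simp
    ultimately show ?thesis
      using d q by (auto simp: x_def)
  qed
  have u_in: "u k \<in> {a..b}" for k
  proof (induction k)
    case (Suc k)
    then show ?case
      using step[of k] by auto
  qed (use u0 \<open>a \<le> b\<close> in auto)
  then show "u k \<in> {a..b}" .
  have "decseq u"
    using step u_in by (auto simp: decseq_Suc_iff)
  then obtain L where L: "u \<longlonglongrightarrow> L"
    using decseq_convergent[of u a] u_in by (metis atLeastAtMost_iff)
  have L_in: "L \<in> {a..b}"
    using closed_sequentially[OF closed_real_atLeastAtMost _ L] u_in by blast
  have lim_g: "(\<lambda>k. g (u k)) \<longlonglongrightarrow> g L"
    using continuous_on_tendsto_compose[OF cont L L_in] u_in by auto
  \<comment> \<open>Successive iterates share the limit \<open>L\<close>, so the bound from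
    \<open>step\<close> becomes \<open>- g L \<le> 0\<close>, which only \<open>L = a\<close>
    satisfies.\<close>
  have "(\<lambda>k. K / \<epsilon> * (u k - u (Suc k))) \<longlonglongrightarrow> K / \<epsilon> * (L - L)"
    by (intro tendsto_intros L LIMSEQ_Suc)
  then have "- g L \<le> K / \<epsilon> * (L - L)"
    using tendsto_minus[OF lim_g] step u_in by (intro LIMSEQ_le) auto
  then have "g L \<ge> 0"
    by simp
  then have "L = a"
    using neg[of L] L_in by force
  with L show "u \<longlonglongrightarrow> a"
    by simp
qed

section \<open>Derivative and concavity of \<open>mu_G\<close>, sign of \<open>mu_c\<close>\<close>

lemma mu_G_eq:
  assumes "cos (\<theta> - x) \<noteq> 0"
  shows "mu_G \<theta> x = cos x - cos \<theta> / cos (\<theta> - x)"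
proof -
  \<comment> \<open>Splitting \<open>\<theta>\<close> as \<open>x + (\<theta> - x)\<close> turns the
    product into a sum whose two terms are both concave on \<open>{0..\<theta>}\<close> when
    \<open>0 \<le> \<theta> < pi / 2\<close>.\<close>
  have "cos \<theta> = cos x * cos (\<theta> - x) - sin x * sin (\<theta> - x)"
    using cos_add[of x "\<theta> - x"] by simp
  then show ?thesis
    using assms by (simp add: mu_G_def tan_def field_simps)
qed

lemma mu_G_has_real_derivative:
  assumes "cos (\<theta> - x) \<noteq> 0"
  shows "(mu_G \<theta> has_real_derivative cos \<theta> * sin (\<theta> - x) / (cos (\<theta> - x))\<^sup>2 - sin x) (at x)"
proof -
  \<comment> \<open>The rewritten form agrees with \<open>mu_G\<close> only where the cosine is
    nonzero; by continuity this holds near \<open>x\<close>, which suffices for the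
    derivative.\<close>
  have "((\<lambda>y. cos (\<theta> - y)) \<longlongrightarrow> cos (\<theta> - x)) (nhds x)"
    by (intro tendsto_intros filterlim_ident)
  then have "eventually (\<lambda>y. cos (\<theta> - y) \<noteq> 0) (nhds x)"
    using assms by (rule tendsto_imp_eventually_ne)
  then have ev: "eventually (\<lambda>y. mu_G \<theta> y = cos y - cos \<theta> / cos (\<theta> - y)) (nhds x)"
    by eventually_elim (rule mu_G_eq)
  have "((\<lambda>y. cos y - cos \<theta> / cos (\<theta> - y)) has_real_derivative
      cos \<theta> * sin (\<theta> - x) / (cos (\<theta> - x))\<^sup>2 - sin x) (at x)"
    using assms by (auto intro!: derivative_eq_intros simp: power2_eq_square)
  then show ?thesis
    using DERIV_cong_ev[OF refl ev refl] by simp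
qed

lemma deriv_mu_G:
  assumes "0 \<le> x" "x \<le> \<theta>" "\<theta> < pi / 2"
  shows "deriv (mu_G \<theta>) x = cos \<theta> * sin (\<theta> - x) / (cos (\<theta> - x))\<^sup>2 - sin x"
proof -
  have "cos (\<theta> - x) > 0"
    using assms by (intro cos_gt_zero_pi) auto
  then show ?thesis
    using mu_G_has_real_derivative by (intro DERIV_imp_deriv) auto
qed

text \<open>As the argument grows towards \<open>\<theta>\<close>, the numerator
  \<open>sin (\<theta> - x)\<close> falls, the denominator rises and \<open>- sin x\<close> falls.
  This lets \<open>- mu_G'\<close> at a mean value point be bounded by its value further
  right.\<close>

lemma deriv_mu_G_antimono:
  assumes "0 \<le> x" "x \<le> y" "y \<le> \<theta>" "\<theta> < pi / 2"
  shows "deriv (mu_G \<theta>) y \<le> deriv (mu_G \<theta>) x"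
proof -
  have "sin (\<theta> - y) \<le> sin (\<theta> - x)"
    using assms by (intro sin_monotone_2pi_le) auto
  moreover have "cos (\<theta> - x) \<le> cos (\<theta> - y)"
    using assms by (intro cos_monotone_0_pi_le) auto
  moreover have "cos (\<theta> - x) > 0"
    using assms by (intro cos_gt_zero_pi) auto
  moreover have "sin (\<theta> - x) \<ge> 0" "sin (\<theta> - y) \<ge> 0"
    using assms by (auto intro!: sin_ge_zero)
  ultimately have "sin (\<theta> - y) / (cos (\<theta> - y))\<^sup>2 \<le> sin (\<theta> - x) / (cos (\<theta> - x))\<^sup>2"
    by (intro frac_le power_mono) auto
  moreover have "cos \<theta> \<ge> 0"
    using assms by (intro cos_ge_zero) auto
  ultimately have "cos \<theta> * (sin (\<theta> - y) / (cos (\<theta> - y))\<^sup>2) \<le> cos \<theta> * (sin (\<theta> - x) / (cos (\<theta> - x))\<^sup>2)"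
    by (rule mult_left_mono)
  moreover have "sin x \<le> sin y"
    using assms by (intro sin_monotone_2pi_le) auto
  ultimately show ?thesis
    using assms by (simp add: deriv_mu_G)
qed

text \<open>The quotient in the derivative is non-negative, leaving
  \<open>- mu_G' \<le> sin x\<close>. This serves the uniform bound on the denominator of
  \<open>\<rho>\<close>.\<close>

lemma deriv_mu_G_ge:
  assumes "0 \<le> x" "x \<le> \<theta>" "\<theta> < pi / 2"
  shows "- deriv (mu_G \<theta>) x \<le> 1"
proof -
  have "0 \<le> cos \<theta> * sin (\<theta> - x) / (cos (\<theta> - x))\<^sup>2"
    using assms by (intro divide_nonneg_nonneg mult_nonneg_nonneg cos_ge_zero sin_ge_zero) auto
  then show ?thesis
    using deriv_mu_G[OF assms] sin_le_one[of x] by linarith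
qed

text \<open>The exponent is at most 0, so the argument of \<open>arccos\<close> lies in
  \<open>[0, 1]\<close> and \<open>tip_loss\<close> is non-negative. Where \<open>tip_loss\<close>
  is 0, as for \<open>s = 1\<close>, division by zero yields 0 and the claim persists.\<close>

lemma mu_c_nonneg:
  assumes "\<sigma> \<ge> 0" "0 < s" "s \<le> 1" "0 < x" "x < pi" "C (x - \<gamma>) \<ge> 0"
  shows "mu_c \<sigma> B s \<gamma> C x \<ge> 0"
proof -
  have "sin x > 0"
    using assms by (intro sin_gt_zero) auto
  then have "exp (- (real B / 2 * (1 - s) / (s * sin x))) \<le> 1"
    using assms by auto
  then have "tip_loss B s x \<ge> 0"
    unfolding tip_loss_def
    by (intro mult_nonneg_nonneg arccos_lbound)
      (auto intro: order_trans[OF _ exp_ge_zero])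
  then show ?thesis
    using assms by (simp add: mu_c_def)
qed

theorem theorem4p1:
  fixes lam \<sigma> \<gamma> \<beta> s \<theta> \<epsilon> M :: real
    and B :: nat
    and C_L C_D \<mu>_L' \<mu>_D' :: "real \<Rightarrow> real"
    and \<phi> :: "nat \<Rightarrow> real"
  defines "Ip \<equiv> I_plus \<theta> \<gamma> \<beta>"
    and "\<mu>_L \<equiv> mu_c \<sigma> B s \<gamma> C_L"
    and "\<mu>_D \<equiv> mu_c \<sigma> B s \<gamma> C_D"
  defines "Sol \<equiv> {x \<in> Ip. \<mu>_L x - tan (\<theta> - x) * \<mu>_D x = mu_G \<theta> x}"
    and "\<rho> \<equiv> (\<lambda>x. \<epsilon> / (max 0 (- deriv (mu_G \<theta>) x) + M + (1 + (tan \<theta>)\<^sup>2) * \<mu>_D x))"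
  defines "f \<equiv> (\<lambda>x. x + \<rho> x * (mu_G \<theta> x - \<mu>_L x + tan (\<theta> - x) * \<mu>_D x))"
  assumes "lam > 0" and "\<sigma> > 0" and "- (pi / 2) < \<gamma>" and "\<gamma> < pi / 2" and "\<beta> > 0"
    and "B \<ge> 1" and "0 < s" and "s < 1"
    and "continuous_on {- \<beta>..\<beta>} C_L" and "\<forall>x\<in>{0<..\<beta>}. C_L x > 0"
    and "continuous_on UNIV C_D" and "\<forall>x. C_D x \<ge> 0"
    and "0 < \<theta>" and "\<theta> < pi / 2" and "tan \<theta> = 1 / lam"
    and "is_greatest Ip \<theta>"
    and "\<forall>x\<in>Ip. (\<mu>_L has_real_derivative \<mu>_L' x) (at x within Ip)"
    and "continuous_on Ip \<mu>_L'"
    and "\<forall>x\<in>Ip. (\<mu>_D has_real_derivative \<mu>_D' x) (at x within Ip)"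
    and "continuous_on Ip \<mu>_D'"
    and "mono_on Ip \<mu>_L" and "mono_on Ip \<mu>_D"
    and "is_greatest (\<mu>_L' ` Ip) M"
    and "Sol \<noteq> {}"
    and "0 < \<epsilon>" and "\<epsilon> < 1"
    and "\<phi> 0 = \<theta>" and "\<forall>k. \<phi> (Suc k) = f (\<phi> k)"
  shows "(\<forall>k. \<phi> k \<in> Ip) \<and> (\<exists>\<phi>_star. is_greatest Sol \<phi>_star \<and> \<phi> \<longlonglongrightarrow> \<phi>_star)"
proof -

  \<comment> \<open>Signs and one-sided derivatives on \<open>Ip\<close>\<close>
  define g where "g x = mu_G \<theta> x - \<mu>_L x + tan (\<theta> - x) * \<mu>_D x" for x
  define D where "D x = max 0 (- deriv (mu_G \<theta>) x) + M + (1 + (tan \<theta>)\<^sup>2) * \<mu>_D x" for x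
  have \<theta>: "0 < \<theta>" "\<theta> < pi / 2"
    by fact+
  have Ip: "0 < x" "x \<le> \<theta>" if "x \<in> Ip" for x
    using that by (auto simp: Ip_def I_plus_def)
  have \<theta>_Ip: "\<theta> \<in> Ip"
    using \<open>is_greatest Ip \<theta>\<close> by (simp add: is_greatest_def)
  have sub: "{x..\<theta>} \<subseteq> Ip" if "x \<in> Ip" for x
    using that \<theta>_Ip by (auto simp: Ip_def I_plus_def I_set_def)
  have Sol_eq: "Sol = {x \<in> Ip. g x = 0}"
    by (auto simp: Sol_def g_def)
  have cos_pos: "cos (\<theta> - x) > 0" if "x \<in> Ip" for x
    using Ip[OF that] \<theta> by (intro cos_gt_zero_pi) auto
  have tan_nonneg: "tan (\<theta> - x) \<ge> 0" if "x \<in> Ip" for x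
    using Ip[OF that] \<theta> tan_pos_pi2_le by simp
  have \<mu>_D_nonneg: "\<mu>_D x \<ge> 0" if "x \<in> Ip" for x
    using Ip[OF that] \<theta> \<open>\<sigma> > 0\<close> \<open>0 < s\<close> \<open>s < 1\<close> \<open>\<forall>x. C_D x \<ge> 0\<close>
    by (auto simp: \<mu>_D_def intro!: mu_c_nonneg)
  have dL: "(\<mu>_L has_real_derivative \<mu>_L' x) (at x within Ip)"
    and dD: "(\<mu>_D has_real_derivative \<mu>_D' x) (at x within Ip)" if "x \<in> Ip" for x
    using that \<open>\<forall>x\<in>Ip. (\<mu>_L has_real_derivative \<mu>_L' x) (at x within Ip)\<close>
      \<open>\<forall>x\<in>Ip. (\<mu>_D has_real_derivative \<mu>_D' x) (at x within Ip)\<close> by blast+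
  have dT: "((\<lambda>x. tan (\<theta> - x)) has_real_derivative - (1 + (tan (\<theta> - x))\<^sup>2)) (at x within Ip)"
    if "x \<in> Ip" for x
  proof -
    have "cos (\<theta> - x) \<noteq> 0"
      using cos_pos[OF that] by simp
    then have "((\<lambda>x. tan (\<theta> - x)) has_real_derivative inverse ((cos (\<theta> - x))\<^sup>2) * (0 - 1)) (at x within Ip)"
      by (intro DERIV_chain2[OF DERIV_tan] DERIV_diff DERIV_const DERIV_ident)
    then show ?thesis
      using tan_sec[OF \<open>cos (\<theta> - x) \<noteq> 0\<close>] by (simp add: power_inverse)
  qed
  have dG: "(mu_G \<theta> has_real_derivative deriv (mu_G \<theta>) x) (at x within Ip)" if "x \<in> Ip" for x
    unfolding deriv_mu_G[OF less_imp_le[OF Ip(1)[OF that]] Ip(2)[OF that] \<theta>(2)]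
    using mu_G_has_real_derivative[OF less_imp_neq[OF cos_pos[OF that], symmetric]]
    by (rule has_field_derivative_at_within)
  have dg: "(g has_real_derivative deriv (mu_G \<theta>) x - \<mu>_L' x
      + (tan (\<theta> - x) * \<mu>_D' x - (1 + (tan (\<theta> - x))\<^sup>2) * \<mu>_D x)) (at x within Ip)"
    if "x \<in> Ip" for x
    unfolding g_def
    using DERIV_add[OF DERIV_diff[OF dG[OF that] dL[OF that]] DERIV_mult[OF dT[OF that] dD[OF that]]]
    by (simp add: algebra_simps)
  have g_cont: "continuous_on Ip g"
    unfolding continuous_on_eq_continuous_within using dg by (blast intro: DERIV_continuous)

  \<comment> \<open>The largest solution and the sign of \<open>g\<close> beyond it\<close>
  obtain c where c: "c \<in> Ip" "g c = 0"
    using \<open>Sol \<noteq> {}\<close> Sol_eq by auto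
  \<comment> \<open>The sign of \<open>C_L\<close> is prescribed only for positive arguments, so
    \<open>\<mu>_L \<theta> \<ge> 0\<close> is derived from the equation at \<open>c\<close> and
    carried to \<open>\<theta>\<close> by monotonicity.\<close>
  have "mu_G \<theta> c \<ge> 0"
    unfolding mu_G_def using Ip[OF c(1)] \<theta> tan_nonneg[OF c(1)]
    by (intro mult_nonneg_nonneg sin_ge_zero) auto
  moreover have "tan (\<theta> - c) * \<mu>_D c \<ge> 0"
    using tan_nonneg[OF c(1)] \<mu>_D_nonneg[OF c(1)] by simp
  ultimately have "0 \<le> \<mu>_L c"
    using c(2) by (simp add: g_def)
  also have "\<mu>_L c \<le> \<mu>_L \<theta>"
    using \<open>mono_on Ip \<mu>_L\<close> c(1) \<theta>_Ip Ip by (auto simp: mono_on_def)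
  finally have "g \<theta> \<le> 0"
    by (simp add: g_def mu_G_def)
  then obtain p where p: "p \<in> {c..\<theta>}" "g p = 0" and neg: "\<And>x. x \<in> {p<..\<theta>} \<Longrightarrow> g x < 0"
    using greatest_zero_exists[of c \<theta> g] c Ip sub[OF c(1)] continuous_on_subset[OF g_cont] by blast
  have p_Ip: "p \<in> Ip"
    using p sub[OF c(1)] by blast
  have p_greatest: "is_greatest Sol p"
    using p p_Ip neg Ip unfolding is_greatest_def Sol_eq by force

  \<comment> \<open>The mean value estimate\<close>
  have slope: "- g x \<le> D x * (x - p)" if x: "x \<in> {p<..\<theta>}" for x
  proof -
    have px: "{p..x} \<subseteq> Ip"
      using sub[OF p_Ip] x by auto
    \<comment> \<open>At an interior point the derivative within \<open>Ip\<close> is two-sided, as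
      needed to read off \<open>\<mu>_D' z \<ge> 0\<close> from monotonicity.\<close>
    have inside: "z \<in> interior Ip" if "p < z" "z < x" for z
    proof -
      have "{p<..<x} \<subseteq> interior Ip"
        using px by (intro interior_maximal) auto
      then show ?thesis
        using that by auto
    qed
    have "\<exists>z\<in>{p<..<x}. g x - g p = (deriv (mu_G \<theta>) z - \<mu>_L' z
      + (tan (\<theta> - z) * \<mu>_D' z - (1 + (tan (\<theta> - z))\<^sup>2) * \<mu>_D z)) * (x - p)"
    proof (rule mvt_simple)
      fix z
      assume "p \<le> z" "z \<le> x"
      then have "z \<in> Ip"
        using px by auto
      from DERIV_subset[OF dg[OF this] px]
      show "(g has_derivative (*) (deriv (mu_G \<theta>) z - \<mu>_L' z
        + (tan (\<theta> - z) * \<mu>_D' z - (1 + (tan (\<theta> - z))\<^sup>2) * \<mu>_D z))) (at z within {p..x})"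
        by (simp only: has_field_derivative_def)
    qed (use x in simp)
    then obtain z where z: "p < z" "z < x" and mvt: "g x - g p = (deriv (mu_G \<theta>) z - \<mu>_L' z
      + (tan (\<theta> - z) * \<mu>_D' z - (1 + (tan (\<theta> - z))\<^sup>2) * \<mu>_D z)) * (x - p)"
      by auto
    have zI: "z \<in> Ip" and xI: "x \<in> Ip"
      using px z x by auto
    \<comment> \<open>Each part of \<open>- g'\<close> at \<open>z\<close> is compared with a
      summand of \<open>D\<close> at the right end \<open>x\<close>: concavity handles
      \<open>mu_G\<close>, the maximum \<open>M\<close> handles \<open>\<mu>_L'\<close>, and
      monotonicity of \<open>tan\<close> and \<open>\<mu>_D\<close> handles the drag. The term with
      \<open>\<mu>_D'\<close> has a favourable sign and is dropped.\<close>
    have "- deriv (mu_G \<theta>) z \<le> - deriv (mu_G \<theta>) x"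
      using deriv_mu_G_antimono[of z x \<theta>] Ip[OF zI] z x \<theta> by auto
    moreover have "\<mu>_L' z \<le> M"
      using \<open>is_greatest (\<mu>_L' ` Ip) M\<close> zI by (auto simp: is_greatest_def)
    moreover have "\<mu>_D' z \<ge> 0"
      using mono_on_imp_deriv_nonneg[OF \<open>mono_on Ip \<mu>_D\<close> _ inside[OF z]] dD[OF zI]
        at_within_interior[OF inside[OF z]] by simp
    then have "tan (\<theta> - z) * \<mu>_D' z \<ge> 0"
      using tan_nonneg[OF zI] by simp
    moreover have "tan (\<theta> - z) \<le> tan \<theta>"
      using Ip[OF zI] \<theta> by (intro tan_mono_le) auto
    then have "(1 + (tan (\<theta> - z))\<^sup>2) * \<mu>_D z \<le> (1 + (tan \<theta>)\<^sup>2) * \<mu>_D x"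
      using tan_nonneg[OF zI] \<mu>_D_nonneg[OF zI] \<open>mono_on Ip \<mu>_D\<close> zI xI z
      by (intro mult_mono add_left_mono power_mono) (auto simp: mono_on_def)
    ultimately have "- (deriv (mu_G \<theta>) z - \<mu>_L' z
      + (tan (\<theta> - z) * \<mu>_D' z - (1 + (tan (\<theta> - z))\<^sup>2) * \<mu>_D z)) \<le> D x"
      unfolding D_def by linarith
    from mult_right_mono[OF this, of "x - p"] mvt p(2) x show ?thesis
      by (simp only: mult_minus_left) simp
  qed
  \<comment> \<open>The 1 bounds \<open>max 0 (- mu_G')\<close>, and \<open>\<mu>_D\<close> is
    largest at \<open>\<theta>\<close>.\<close>
  have bound: "D x \<le> 1 + M + (1 + (tan \<theta>)\<^sup>2) * \<mu>_D \<theta>" if "x \<in> {p<..\<theta>}" for x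
  proof -
    have xI: "x \<in> Ip"
      using that sub[OF p_Ip] by auto
    have "\<mu>_D x \<le> \<mu>_D \<theta>"
      using \<open>mono_on Ip \<mu>_D\<close> xI \<theta>_Ip Ip by (auto simp: mono_on_def)
    then have "(1 + (tan \<theta>)\<^sup>2) * \<mu>_D x \<le> (1 + (tan \<theta>)\<^sup>2) * \<mu>_D \<theta>"
      by (intro mult_left_mono) auto
    then show ?thesis
      using deriv_mu_G_ge[of x \<theta>] Ip[OF xI] \<theta> by (simp add: D_def)
  qed

  \<comment> \<open>Convergence of the iterates within \<open>{p..\<theta>}\<close>\<close>
  have rec: "\<phi> (Suc k) = \<phi> k + \<epsilon> / D (\<phi> k) * g (\<phi> k)" for k
    using \<open>\<forall>k. \<phi> (Suc k) = f (\<phi> k)\<close>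
    by (simp add: f_def \<rho>_def D_def g_def)
  have "continuous_on {p..\<theta>} g"
    using g_cont sub[OF p_Ip] by (rule continuous_on_subset)
  note iter = damped_iteration_tendsto_zero[OF this _ p(2) neg slope bound
      \<open>0 < \<epsilon>\<close> less_imp_le[OF \<open>\<epsilon> < 1\<close>] \<open>\<phi> 0 = \<theta>\<close> rec]
  have "\<phi> k \<in> Ip" for k
    using iter(1)[of k] p sub[OF p_Ip] by auto
  moreover have "\<phi> \<longlonglongrightarrow> p"
    using iter(2) p by auto
  ultimately show ?thesis
    using p_greatest by blast
qed

end
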